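(* Let $\beta_0,\beta_1,\beta_2\in\mathbb{R}$ with $\beta_1<0$ and $\beta_2>20\beta_1$. Then for every $M\in[0,2)$ the ground state $\bm{\xi}_g$ of the spatially uniform problem (the minimizer of $\mathcal{E}_U$ over $\mathbb{S}_C$) is in the ferromagnetic phase, and it can be given explicitly by $$\bm{\xi}_g=\left(\frac{m_1^4}{16},\;\frac{m_1^3m_2}{8},\;\frac{\sqrt6\,m_1^2m_2^2}{16},\;\frac{m_1m_2^3}{8},\;\frac{m_2^4}{16}\right)^T,\qquad m_1=\sqrt{2+M},\quad m_2=\sqrt{2-M}.$$
   Context: Vectors are written $\bm{\xi}=(\xi_2,\xi_1,\xi_0,\xi_{-1},\xi_{-2})^T\in\mathbb{C}^5$. Define $$\tau(\bm{\xi})=2(\bar\xi_2\xi_1+\bar\xi_{-1}\xi_{-2})+\sqrt6(\bar\xi_1\xi_0+\bar\xi_0\xi_{-1}),\qquad \delta(\bm{\xi})=2\xi_2\xi_{-2}-2\xi_1\xi_{-1}+\xi_0^2,$$ $$\mathcal{E}_U(\bm{\xi})=\frac12\Big[\beta_1|\tau(\bm{\xi})|^2+\frac{\beta_2}{5}|\delta(\bm{\xi})|^2+\beta_0+\beta_1M^2\Big],$$ $$\mathbb{S}_C=\Big\{\bm{\xi}\in\mathbb{C}^5:\ \sum_{\ell=-2}^2|\xi_\ell|^2=1,\ \sum_{\ell=-2}^2\ell|\xi_\ell|^2=M\Big\}.$$ A ground state is a minimizer of $\mathcal{E}_U$ over $\mathbb{S}_C$; ground states differing by phase rotations $\xi_\ell\mapsto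 e^{i(\theta_0+\ell(\theta_1-\theta_0))}\xi_\ell$, $\theta_0,\theta_1\in\mathbb{R}$, are regarded as the same. It is in the ferromagnetic phase if $|\tau(\bm{\xi}_g)|>0$ and $\delta(\bm{\xi}_g)=0$; in the nematic phase if $\tau(\bm{\xi}_g)=0$ and $|\delta(\bm{\xi}_g)|>0$; in the cyclic phase if $\tau(\bm{\xi}_g)=\delta(\bm{\xi}_g)=0$. "Can be given by" a vector means that this vector is a ground state. *)

theory Defs
  imports "HOL-Analysis.Analysis" "HOL-Library.Numeral_Type"
begin

text \<open>
  A spin-2 vector \<open>(\<xi>\<^sub>2, \<xi>\<^sub>1, \<xi>\<^sub>0, \<xi>\<^sub>-\<^sub>1, \<xi>\<^sub>-\<^sub>2)\<close> is an element of \<open>complex ^ 5\<close>.  Arithmetic in the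
  index type \<open>5\<close> is modulo 5, so the indices \<open>2, 1, 0, -1, -2\<close> are pairwise distinct and exhaust
  the type; \<open>of_int\<close> maps the integers \<open>-2, \<dots>, 2\<close> bijectively onto it.
\<close>

definition spinor :: "complex \<Rightarrow> complex \<Rightarrow> complex \<Rightarrow> complex \<Rightarrow> complex \<Rightarrow> complex ^ 5" where
  "spinor a b c d e =
     (\<chi> i. if i = 2 then a else if i = 1 then b else if i = 0 then c else if i = -1 then d else e)"

lemma spinor_nth [simp]:
  "spinor a b c d e $ 2 = a" "spinor a b c d e $ 1 = b" "spinor a b c d e $ 0 = c"
  "spinor a b c d e $ (-1) = d" "spinor a b c d e $ (-2) = e"
  by (simp_all add: spinor_def)

definition \<tau> :: "complex ^ 5 \<Rightarrow> complex" where
  "\<tau> \<xi> = 2 * (cnj (\<xi> $ 2) * \<xi> $ 1 + cnj (\<xi> $ (-1)) * \<xi> $ (-2))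
        + complex_of_real (sqrt 6) * (cnj (\<xi> $ 1) * \<xi> $ 0 + cnj (\<xi> $ 0) * \<xi> $ (-1))"

definition \<delta> :: "complex ^ 5 \<Rightarrow> complex" where
  "\<delta> \<xi> = 2 * \<xi> $ 2 * \<xi> $ (-2) - 2 * \<xi> $ 1 * \<xi> $ (-1) + (\<xi> $ 0)\<^sup>2"

definition energy :: "real \<Rightarrow> real \<Rightarrow> real \<Rightarrow> real \<Rightarrow> complex ^ 5 \<Rightarrow> real" where
  "energy \<beta>0 \<beta>1 \<beta>2 M \<xi> =
     1 / 2 * (\<beta>1 * (cmod (\<tau> \<xi>))\<^sup>2 + \<beta>2 / 5 * (cmod (\<delta> \<xi>))\<^sup>2 + \<beta>0 + \<beta>1 * M\<^sup>2)"

definition constraint_set :: "real \<Rightarrow> (complex ^ 5) set" where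
  "constraint_set M =
     {\<xi>. (\<Sum>l\<in>{-2..2::int}. (cmod (\<xi> $ of_int l))\<^sup>2) = 1 \<and>
         (\<Sum>l\<in>{-2..2::int}. of_int l * (cmod (\<xi> $ of_int l))\<^sup>2) = M}"

definition ground_state :: "real \<Rightarrow> real \<Rightarrow> real \<Rightarrow> real \<Rightarrow> complex ^ 5 \<Rightarrow> bool" where
  "ground_state \<beta>0 \<beta>1 \<beta>2 M \<xi> \<longleftrightarrow>
     is_arg_min (energy \<beta>0 \<beta>1 \<beta>2 M) (\<lambda>\<eta>. \<eta> \<in> constraint_set M) \<xi>"

definition ferromagnetic :: "complex ^ 5 \<Rightarrow> bool" where
  "ferromagnetic \<xi> \<longleftrightarrow> cmod (\<tau> \<xi>) > 0 \<and> \<delta> \<xi> = 0"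

definition phase_equivalent :: "complex ^ 5 \<Rightarrow> complex ^ 5 \<Rightarrow> bool" where
  "phase_equivalent \<xi> \<eta> \<longleftrightarrow>
     (\<exists>\<theta>0 \<theta>1 :: real. \<forall>l\<in>{-2..2::int}.
        \<eta> $ of_int l = exp (\<i> * complex_of_real (\<theta>0 + of_int l * (\<theta>1 - \<theta>0))) * \<xi> $ of_int l)"

end

theory Submission
  imports Defs
begin

text \<open>
  A spin-2 vector is read as a binary quartic form
  \<open>A x\<^sup>4 + 4 B x\<^sup>3y + 6 C x\<^sup>2y\<^sup>2 + 4 D xy\<^sup>3 + E y\<^sup>4\<close>, where \<open>SU(2)\<close> acts by substitution.
  Then \<open>\<delta>\<close> is twice the classical invariant \<open>AE - 4BD + 3C\<^sup>2\<close>, and \<open>|\<tau>|\<^sup>2 + M\<^sup>2\<close> is the squared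
  length of the spin vector, which for unit vectors is 4 exactly on fourth powers of linear forms (the coherent
  states).

  The gap to 4 is measured by the two remaining quadratic covariants, the invariant and the Hessian
  \<open>H\<close> of the quartic: for normalized vectors \<open>4 - M\<^sup>2 - |\<tau>|\<^sup>2 = 2 |\<delta>|\<^sup>2 + 48 \<parallel>H\<parallel>\<^sup>2\<close>
  (\<open>\<tau>_\<delta>_hessian_norm_sq_identity\<close>).  The invariant of \<open>H\<close> is a multiple of the square
  of the invariant of the quartic, whereas the modulus of the invariant of any quartic is bounded by
  its squared norm; hence \<open>|\<delta>|\<^sup>2 \<le> 24 \<parallel>H\<parallel>\<^sup>2\<close> (\<open>\<delta>_le_hessian_norm_sq\<close>), and together
  \<open>|\<tau>|\<^sup>2 + 4 |\<delta>|\<^sup>2 \<le> 4 - M\<^sup>2\<close>.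

  Multiplied by \<open>\<beta>1 < 0\<close>, this bounds the energy below by
  \<open>const + (\<beta>2/10 - 2 \<beta>1) |\<delta>|\<^sup>2\<close>, and \<open>\<beta>2 > 20 \<beta>1\<close> says that the coefficient is positive.  So the
  energy is least precisely when \<open>\<delta> = 0\<close> and \<open>|\<tau>|\<^sup>2 = 4 - M\<^sup>2\<close>; the identity then forces
  \<open>H = 0\<close>, and a quartic with vanishing Hessian is a fourth power \<open>p (x + s y)\<^sup>4\<close>
  (\<open>fourth_power_spinorI\<close>).  The two constraints determine \<open>|p|\<close> and \<open>|s|\<close>, and the phases of \<open>p\<close>
  and \<open>s\<close> are the two phase rotations.  The vector in the theorem is \<open>(m1 x + m2 y)\<^sup>4 / 16\<close>.
\<close>

section \<open>Spinors as binary quartics\<close>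

lemma exhaust_5:
  fixes x :: 5
  shows "x = 2 \<or> x = 1 \<or> x = 0 \<or> x = -1 \<or> x = -2"
proof (induct x)
  case (of_int z)
  then have "0 \<le> z" and "z < 5" by simp_all
  then have "z = 0 \<or> z = 1 \<or> z = 2 \<or> z = 3 \<or> z = 4" by arith
  then show ?case by auto
qed

text \<open>
  The coefficients of an orthonormal basis of binary quartics carry the square roots of the binomial
  coefficients \<open>1, 4, 6, 4, 1\<close>.  Splitting these off leaves integer coefficients in \<open>\<tau>\<close> and \<open>\<delta>\<close>.
\<close>

definition quartic_spinor ::
    "complex \<Rightarrow> complex \<Rightarrow> complex \<Rightarrow> complex \<Rightarrow> complex \<Rightarrow> complex ^ 5" where
  "quartic_spinor A B C D E = spinor A (2 * B) (complex_of_real (sqrt 6) * C) (2 * D) E"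

lemma quartic_spinor_exhaust:
  obtains A B C D E where "\<xi> = quartic_spinor A B C D E"
proof
  show "\<xi> = quartic_spinor (\<xi> $ 2) (\<xi> $ 1 / 2) (\<xi> $ 0 / complex_of_real (sqrt 6))
              (\<xi> $ (-1) / 2) (\<xi> $ (-2))"
    unfolding vec_eq_iff
  proof
    fix i :: 5
    show "\<xi> $ i = quartic_spinor (\<xi> $ 2) (\<xi> $ 1 / 2) (\<xi> $ 0 / complex_of_real (sqrt 6))
              (\<xi> $ (-1) / 2) (\<xi> $ (-2)) $ i"
      using exhaust_5[of i] by (elim disjE) (simp_all add: quartic_spinor_def)
  qed
qed

lemma quartic_spinor_in_constraint_set:
  "quartic_spinor A B C D E \<in> constraint_set M \<longleftrightarrow>
     (cmod A)\<^sup>2 + 4 * (cmod B)\<^sup>2 + 6 * (cmod C)\<^sup>2 + 4 * (cmod D)\<^sup>2 + (cmod E)\<^sup>2 = 1 \<and>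
     2 * (cmod A)\<^sup>2 + 4 * (cmod B)\<^sup>2 - 4 * (cmod D)\<^sup>2 - 2 * (cmod E)\<^sup>2 = M"
proof -
  have "{-2..2::int} = {-2, -1, 0, 1, 2}" by auto
  then show ?thesis
    by (auto simp: constraint_set_def quartic_spinor_def norm_mult power_mult_distrib)
qed

lemma \<tau>_quartic_spinor:
  "\<tau> (quartic_spinor A B C D E) =
     4 * (cnj A * B + cnj D * E) + 12 * (cnj B * C + cnj C * D)"
proof -
  have [simp]: "complex_of_real (sqrt 6) * complex_of_real (sqrt 6) = 6"
    by (simp flip: of_real_mult)
  have "x * complex_of_real (sqrt 6) * (complex_of_real (sqrt 6) * y) = 6 * x * y" for x y
    by (simp add: algebra_simps flip: mult.assoc)
  then show ?thesis
    by (simp add: \<tau>_def quartic_spinor_def algebra_simps)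
qed

lemma \<delta>_quartic_spinor:
  "\<delta> (quartic_spinor A B C D E) = 2 * (A * E - 4 * B * D + 3 * C\<^sup>2)"
  by (simp add: \<delta>_def quartic_spinor_def algebra_simps power_mult_distrib flip: of_real_power)

section \<open>The bound on \<open>\<tau>\<close> and \<open>\<delta>\<close>\<close>

text \<open>
  Up to the factor 144, \<open>f\<^sub>x\<^sub>x f\<^sub>y\<^sub>y - f\<^sub>x\<^sub>y\<^sup>2\<close> is the quartic with coefficients
  \<open>H0, 2 H1, H2, 2 H3, H4\<close>, where \<open>H0, \<dots>, H4\<close> are the five quadrics below; dividing by the binomial
  coefficients gives the weights \<open>1, 1, 1/6, 1, 1\<close> of its squared norm.
\<close>

definition hessian_norm_sq :: "complex \<Rightarrow> complex \<Rightarrow> complex \<Rightarrow> complex \<Rightarrow> complex \<Rightarrow> real" where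
  "hessian_norm_sq A B C D E =
     (cmod (A * C - B\<^sup>2))\<^sup>2 + (cmod (A * D - B * C))\<^sup>2
     + (cmod (A * E + 2 * B * D - 3 * C\<^sup>2))\<^sup>2 / 6
     + (cmod (B * E - C * D))\<^sup>2 + (cmod (C * E - D\<^sup>2))\<^sup>2"

text \<open>
  The symmetric square of the spin-2 representation is a sum of the representations of spin 4, 2
  and 0.  The last two components are \<open>H\<close> and \<open>\<delta>\<close>.  The squared length of the spin vector is the
  expectation of the product of the two spins in two copies of the vector, and so a combination of the squared norms
  of the three components; eliminating spin 4 by the total norm leaves this identity.
\<close>

lemma \<tau>_\<delta>_hessian_norm_sq_identity:
  assumes "quartic_spinor A B C D E \<in> constraint_set M"
  shows "4 - M\<^sup>2 - (cmod (\<tau> (quartic_spinor A B C D E)))\<^sup>2 =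
           2 * (cmod (\<delta> (quartic_spinor A B C D E)))\<^sup>2 + 48 * hessian_norm_sq A B C D E"
proof -
  define n where
    "n = (cmod A)\<^sup>2 + 4 * (cmod B)\<^sup>2 + 6 * (cmod C)\<^sup>2 + 4 * (cmod D)\<^sup>2 + (cmod E)\<^sup>2"
  have n: "n = 1"
    and M: "M = 2 * (cmod A)\<^sup>2 + 4 * (cmod B)\<^sup>2 - 4 * (cmod D)\<^sup>2 - 2 * (cmod E)\<^sup>2"
    using assms by (simp_all add: quartic_spinor_in_constraint_set n_def)
  \<comment> \<open>Written with the norm \<open>n\<close>, the claim is homogeneous, hence a polynomial identity in the
    coefficients and their conjugates.\<close>
  have "complex_of_real (4 * (n * n) - M * M - (cmod (\<tau> (quartic_spinor A B C D E)))\<^sup>2) =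
        complex_of_real (2 * (cmod (\<delta> (quartic_spinor A B C D E)))\<^sup>2 + 48 * hessian_norm_sq A B C D E)"
    unfolding M n_def hessian_norm_sq_def \<tau>_quartic_spinor \<delta>_quartic_spinor
    by (simp only: of_real_add of_real_diff of_real_mult of_real_divide of_real_numeral
        complex_norm_square complex_cnj_add complex_cnj_diff complex_cnj_mult complex_cnj_power
        complex_cnj_numeral complex_cnj_cnj)
      (simp add: field_simps power2_eq_square)
  then show ?thesis
    unfolding of_real_eq_iff by (simp add: n power2_eq_square)
qed

text \<open>
  The invariant of the Hessian is a multiple of the squared invariant of the quartic.  Since the
  invariant is a quadratic form pairing opposite coefficients, the inequality of arithmetic and
  geometric means bounds it by the squared norm.
\<close>

lemma \<delta>_le_hessian_norm_sq:
  "(cmod (\<delta> (quartic_spinor A B C D E)))\<^sup>2 \<le> 24 * hessian_norm_sq A B C D E"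
proof -
  define H0 where "H0 = A * C - B\<^sup>2"
  define H1 where "H1 = A * D - B * C"
  define H2 where "H2 = A * E + 2 * B * D - 3 * C\<^sup>2"
  define H3 where "H3 = B * E - C * D"
  define H4 where "H4 = C * E - D\<^sup>2"
  have am_gm: "48 * (x * y) \<le> 24 * (x\<^sup>2 + y\<^sup>2)" for x y :: real
    using sum_squares_bound[of x y] by (simp add: mult.assoc)
  \<comment> \<open>The right-hand side is 48 times the invariant of the Hessian.\<close>
  have "(\<delta> (quartic_spinor A B C D E))\<^sup>2 = 48 * (H0 * H4) - 48 * (H1 * H3) + 4 * H2\<^sup>2"
    unfolding \<delta>_quartic_spinor H0_def H1_def H2_def H3_def H4_def
    by (simp add: algebra_simps power2_eq_square)
  then have "(cmod (\<delta> (quartic_spinor A B C D E)))\<^sup>2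
      = cmod (48 * (H0 * H4) - 48 * (H1 * H3) + 4 * H2\<^sup>2)"
    by (metis norm_power)
  also have "\<dots> \<le> cmod (48 * (H0 * H4)) + cmod (48 * (H1 * H3)) + cmod (4 * H2\<^sup>2)"
    by (meson add_right_mono norm_triangle_ineq norm_triangle_ineq4 order_trans)
  also have "\<dots> = 48 * (cmod H0 * cmod H4) + 48 * (cmod H1 * cmod H3) + 4 * (cmod H2)\<^sup>2"
    by (simp add: norm_mult norm_power)
  also have "\<dots> \<le> 24 * ((cmod H0)\<^sup>2 + (cmod H4)\<^sup>2) + 24 * ((cmod H1)\<^sup>2 + (cmod H3)\<^sup>2)
                  + 4 * (cmod H2)\<^sup>2"
    by (intro add_mono am_gm order_refl)
  also have "\<dots> = 24 * hessian_norm_sq A B C D E"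
    by (simp add: hessian_norm_sq_def H0_def H1_def H2_def H3_def H4_def)
  finally show ?thesis .
qed

lemma \<tau>_\<delta>_bound:
  assumes "\<xi> \<in> constraint_set M"
  shows "(cmod (\<tau> \<xi>))\<^sup>2 + 4 * (cmod (\<delta> \<xi>))\<^sup>2 \<le> 4 - M\<^sup>2"
proof -
  obtain A B C D E where \<xi>: "\<xi> = quartic_spinor A B C D E"
    by (rule quartic_spinor_exhaust)
  show ?thesis
    using \<tau>_\<delta>_hessian_norm_sq_identity assms \<delta>_le_hessian_norm_sq[of A B C D E] unfolding \<xi> by fastforce
qed

section \<open>The case of equality: fourth powers\<close>

text \<open>
  This is the quartic \<open>p (x + s y)\<^sup>4\<close>.  The only other fourth powers are the multiples of \<open>y\<^sup>4\<close>, which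
  have magnetization \<open>-2\<close>.
\<close>

definition fourth_power_spinor :: "complex \<Rightarrow> complex \<Rightarrow> complex ^ 5" where
  "fourth_power_spinor p s = quartic_spinor p (p * s) (p * s\<^sup>2) (p * s ^ 3) (p * s ^ 4)"

lemma fourth_power_spinor_in_constraint_set:
  "fourth_power_spinor p s \<in> constraint_set M \<longleftrightarrow>
     (cmod p)\<^sup>2 * (1 + (cmod s)\<^sup>2) ^ 4 = 1 \<and>
     2 * (cmod p)\<^sup>2 * (1 - (cmod s)\<^sup>2) * (1 + (cmod s)\<^sup>2) ^ 3 = M"
  unfolding fourth_power_spinor_def quartic_spinor_in_constraint_set
  by (simp add: norm_mult norm_power algebra_simps power_mult_distrib
      power2_eq_square power3_eq_cube power4_eq_xxxx)

lemma \<delta>_fourth_power_spinor: "\<delta> (fourth_power_spinor p s) = 0"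
  by (simp add: fourth_power_spinor_def \<delta>_quartic_spinor algebra_simps
      power2_eq_square power3_eq_cube power4_eq_xxxx)

lemma \<tau>_fourth_power_spinor:
  assumes "fourth_power_spinor p s \<in> constraint_set M"
  shows "(cmod (\<tau> (fourth_power_spinor p s)))\<^sup>2 = 4 - M\<^sup>2"
proof -
  have "hessian_norm_sq p (p * s) (p * s\<^sup>2) (p * s ^ 3) (p * s ^ 4) = 0"
    by (simp add: hessian_norm_sq_def algebra_simps
        power2_eq_square power3_eq_cube power4_eq_xxxx)
  then show ?thesis
    using \<tau>_\<delta>_hessian_norm_sq_identity[OF assms[unfolded fourth_power_spinor_def]]
      \<delta>_fourth_power_spinor[of p s]
    by (simp add: fourth_power_spinor_def)
qed

text \<open>
  A vanishing Hessian together with a vanishing invariant gives the equations of the rational normal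
  quartic, so the coefficients form a geometric progression as soon as the first one is nonzero.
\<close>

lemma fourth_power_spinorI:
  assumes \<xi>: "\<xi> \<in> constraint_set M" and "-2 < M"
    and \<delta>: "\<delta> \<xi> = 0" and \<tau>: "(cmod (\<tau> \<xi>))\<^sup>2 = 4 - M\<^sup>2"
  obtains p s where "\<xi> = fourth_power_spinor p s"
proof -
  obtain A B C D E where q: "\<xi> = quartic_spinor A B C D E"
    by (rule quartic_spinor_exhaust)
  have "hessian_norm_sq A B C D E = 0"
    using \<tau>_\<delta>_hessian_norm_sq_identity[of A B C D E M] \<xi> \<delta> \<tau> by (simp add: q)
  then have H: "A * C = B\<^sup>2" "A * D = B * C" "A * E + 2 * B * D = 3 * C\<^sup>2"
      "B * E = C * D" "C * E = D\<^sup>2"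
    unfolding hessian_norm_sq_def by (simp_all add: add_nonneg_eq_0_iff)
  have "A * E - 4 * B * D + 3 * C\<^sup>2 = 0"
    using \<delta> unfolding q \<delta>_quartic_spinor by (simp only: mult_eq_0_iff) simp
  with H(3) have AE: "A * E = B * D" and BD: "B * D = C\<^sup>2"
    by algebra+
  have "A \<noteq> 0"
  proof
    assume "A = 0"
    then have "B = 0" using H(1) by simp
    then have "C = 0" using BD by simp
    then have "D = 0" using H(5) by simp
    have "M = -2"
      using \<xi> \<open>A = 0\<close> \<open>B = 0\<close> \<open>C = 0\<close> \<open>D = 0\<close>
      by (simp add: q quartic_spinor_in_constraint_set)
    with \<open>-2 < M\<close> show False by simp
  qed
  define s where "s = B / A"
  have B: "B = A * s" using \<open>A \<noteq> 0\<close> by (simp add: s_def)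
  have C: "C = A * s\<^sup>2"
    using H(1) \<open>A \<noteq> 0\<close> by (simp add: B power2_eq_square)
  have D: "D = A * s ^ 3"
    using H(2) \<open>A \<noteq> 0\<close> by (simp add: B C power2_eq_square power3_eq_cube)
  have E: "E = A * s ^ 4"
    using AE \<open>A \<noteq> 0\<close> by (simp add: B D power3_eq_cube power4_eq_xxxx)
  have "\<xi> = fourth_power_spinor A s"
    by (simp add: q fourth_power_spinor_def B C D E)
  then show thesis by (rule that)
qed

text \<open>
  Dividing the second constraint by the first leaves \<open>M = 2 (1 - r) / (1 + r)\<close> for
  \<open>r = |s|\<^sup>2\<close>, which is injective in \<open>r\<close>.
\<close>

lemma fourth_power_spinor_moduli:
  assumes "fourth_power_spinor p s \<in> constraint_set M" and "-2 < M" and "M \<le> 2"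
  shows "cmod p = (2 + M)\<^sup>2 / 16" and "cmod s = sqrt (2 - M) / sqrt (2 + M)"
proof -
  define r where "r = (cmod s)\<^sup>2"
  have "0 \<le> r" by (simp add: r_def)
  have n: "(cmod p)\<^sup>2 * (1 + r) ^ 4 = 1"
    and M: "2 * (cmod p)\<^sup>2 * (1 - r) * (1 + r) ^ 3 = M"
    using assms(1) by (simp_all add: fourth_power_spinor_in_constraint_set r_def)
  have "M * (1 + r) = 2 * (1 - r) * ((cmod p)\<^sup>2 * (1 + r) ^ 4)"
    by (simp add: power_eq_if flip: M)
  then have "M * (1 + r) = 2 * (1 - r)" by (simp add: n)
  then have r: "r = (2 - M) / (2 + M)" and r1: "1 + r = 4 / (2 + M)"
    using \<open>-2 < M\<close> by (simp_all add: field_simps)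
  have "cmod s = sqrt r" by (simp add: r_def)
  then show "cmod s = sqrt (2 - M) / sqrt (2 + M)"
    by (simp add: r real_sqrt_divide)
  have "(cmod p * (1 + r)\<^sup>2)\<^sup>2 = 1\<^sup>2"
    using n by (simp add: power_mult_distrib flip: power_mult)
  then have "cmod p * (1 + r)\<^sup>2 = 1"
    by (rule power2_eq_imp_eq) simp_all
  then show "cmod p = (2 + M)\<^sup>2 / 16"
    using \<open>-2 < M\<close> by (simp add: r1 power_divide field_simps)
qed

lemma fourth_power_spinor_in_constraint_set_real:
  assumes "-2 < M" and "M \<le> 2"
  shows "fourth_power_spinor (of_real ((2 + M)\<^sup>2 / 16)) (of_real (sqrt (2 - M) / sqrt (2 + M)))
           \<in> constraint_set M"
proof -
  define k where "k = 2 + M"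
  have M: "M = k - 2" and "0 < k" and "k \<le> 4"
    using assms by (simp_all add: k_def)
  have "1 + (4 - k) / k = 4 / k" and "1 - (4 - k) / k = 2 * (k - 2) / k"
    using \<open>0 < k\<close> by (simp_all add: field_simps)
  moreover have "(sqrt (4 - k) / sqrt k)\<^sup>2 = (4 - k) / k"
    using \<open>0 < k\<close> \<open>k \<le> 4\<close> by (simp add: power_divide)
  ultimately show ?thesis
    using \<open>0 < k\<close> unfolding fourth_power_spinor_in_constraint_set norm_of_real power2_abs M
    by (simp add: field_simps power2_eq_square power3_eq_cube power4_eq_xxxx)
qed

lemma same_norm_imp_phase:
  fixes z w :: complex
  assumes "cmod z = cmod w"
  obtains \<alpha> where "w = exp (\<i> * complex_of_real \<alpha>) * z"
proof (cases "z = 0")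
  case True
  then show thesis using assms that[of 0] by simp
next
  case False
  then have "cmod (w / z) = 1" using assms by (auto simp: norm_divide)
  then obtain \<alpha> where "w / z = exp (\<i> * complex_of_real \<alpha>)"
    unfolding complex_norm_eq_1_exp by metis
  then show thesis using False that[of \<alpha>] by (simp add: field_simps)
qed

text \<open>
  The component with index \<open>l\<close> is a constant times \<open>p s\<^bsup>2 - l\<^esup>\<close>, so changes of phase \<open>\<alpha>\<close> of \<open>p\<close> and \<open>\<phi>\<close>
  of \<open>s\<close> rotate it by \<open>\<alpha> + (2 - l) \<phi>\<close>, which is affine in \<open>l\<close>.
\<close>

lemma phase_equivalent_fourth_power_spinor:
  assumes "cmod p = cmod q" and "cmod s = cmod t"
  shows "phase_equivalent (fourth_power_spinor p s) (fourth_power_spinor q t)"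
proof -
  obtain \<alpha> where \<alpha>: "q = exp (\<i> * complex_of_real \<alpha>) * p"
    using same_norm_imp_phase[OF assms(1)] .
  obtain \<phi> where \<phi>: "t = exp (\<i> * complex_of_real \<phi>) * s"
    using same_norm_imp_phase[OF assms(2)] .
  have phase: "exp (\<i> * complex_of_real (\<alpha> + real k * \<phi>)) =
                 exp (\<i> * complex_of_real \<alpha>) * exp (\<i> * complex_of_real \<phi>) ^ k" for k
    by (simp add: distrib_left exp_add mult.left_commute flip: exp_of_nat_mult)
  define \<theta>0 where "\<theta>0 = \<alpha> + 2 * \<phi>"
  define \<theta>1 where "\<theta>1 = \<alpha> + \<phi>"
  have "\<forall>l\<in>{-2..2::int}. fourth_power_spinor q t $ of_int l =
          exp (\<i> * complex_of_real (\<theta>0 + of_int l * (\<theta>1 - \<theta>0)))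
            * fourth_power_spinor p s $ of_int l"
  proof
    fix l :: int
    assume "l \<in> {-2..2}"
    then consider "l = 2" | "l = 1" | "l = 0" | "l = -1" | "l = -2" by fastforce
    moreover have "\<theta>0 + of_int l * (\<theta>1 - \<theta>0) = \<alpha> + real (nat (2 - l)) * \<phi>"
      using \<open>l \<in> {-2..2}\<close> by (simp add: \<theta>0_def \<theta>1_def algebra_simps)
    ultimately show "fourth_power_spinor q t $ of_int l =
          exp (\<i> * complex_of_real (\<theta>0 + of_int l * (\<theta>1 - \<theta>0)))
            * fourth_power_spinor p s $ of_int l"
      by cases (simp_all only: phase, simp_all add: fourth_power_spinor_def quartic_spinor_def
          \<alpha> \<phi> power_mult_distrib)
  qed
  then show ?thesis
    unfolding phase_equivalent_def by blast
qed

section \<open>Ground states\<close>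

lemma energy_ge:
  assumes "\<beta>1 < 0" and "\<beta>2 > 20 * \<beta>1" and "\<xi> \<in> constraint_set M"
  shows "2 * \<beta>1 + \<beta>0 / 2 + (\<beta>2 / 10 - 2 * \<beta>1) * (cmod (\<delta> \<xi>))\<^sup>2 \<le> energy \<beta>0 \<beta>1 \<beta>2 M \<xi>"
proof -
  have "\<beta>1 * (4 - M\<^sup>2) \<le> \<beta>1 * ((cmod (\<tau> \<xi>))\<^sup>2 + 4 * (cmod (\<delta> \<xi>))\<^sup>2)"
    using \<tau>_\<delta>_bound[OF assms(3)] assms(1) by (simp add: mult_left_mono_neg)
  then show ?thesis
    unfolding energy_def by (simp add: algebra_simps)
qed

text \<open>
  On fourth powers the lower bound of \<open>energy_ge\<close> is attained with \<open>\<delta> = 0\<close>, and they exist in the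
  constraint set; so a minimizer meets equality in both steps of the bound.
\<close>

lemma ground_state_iff:
  assumes "\<beta>1 < 0" and "\<beta>2 > 20 * \<beta>1" and "-2 < M" and "M \<le> 2"
  shows "ground_state \<beta>0 \<beta>1 \<beta>2 M \<xi> \<longleftrightarrow>
           \<xi> \<in> constraint_set M \<and> (\<exists>p s. \<xi> = fourth_power_spinor p s)"
    (is "_ \<longleftrightarrow> ?R \<xi>")
proof -
  define e where "e = 2 * \<beta>1 + \<beta>0 / 2"
  have lower: "e \<le> energy \<beta>0 \<beta>1 \<beta>2 M \<eta>" if "\<eta> \<in> constraint_set M" for \<eta>
  proof -
    have "0 \<le> (\<beta>2 / 10 - 2 * \<beta>1) * (cmod (\<delta> \<eta>))\<^sup>2"
      using assms(2) by (intro mult_nonneg_nonneg) simp_all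
    then show ?thesis
      using energy_ge[OF assms(1,2) that, of \<beta>0] by (simp add: e_def)
  qed
  have attained: "energy \<beta>0 \<beta>1 \<beta>2 M \<eta> = e" if "?R \<eta>" for \<eta>
  proof -
    have \<tau>: "(cmod (\<tau> \<eta>))\<^sup>2 = 4 - M\<^sup>2" and \<delta>: "\<delta> \<eta> = 0"
      using that \<tau>_fourth_power_spinor \<delta>_fourth_power_spinor by blast+
    show ?thesis
      unfolding energy_def e_def \<tau> \<delta> by (simp add: algebra_simps)
  qed
  have only: "?R \<eta>" if \<eta>: "\<eta> \<in> constraint_set M" and le: "energy \<beta>0 \<beta>1 \<beta>2 M \<eta> \<le> e" for \<eta>
  proof -
    have "(\<beta>2 / 10 - 2 * \<beta>1) * (cmod (\<delta> \<eta>))\<^sup>2 \<le> 0"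
      using energy_ge[OF assms(1,2) \<eta>, of \<beta>0] le by (simp add: e_def)
    then have \<delta>: "\<delta> \<eta> = 0"
      using assms(2) by (simp add: mult_le_0_iff)
    have "\<beta>1 * (cmod (\<tau> \<eta>))\<^sup>2 \<le> \<beta>1 * (4 - M\<^sup>2)"
      using le by (simp add: \<delta> energy_def e_def algebra_simps)
    then have "4 - M\<^sup>2 \<le> (cmod (\<tau> \<eta>))\<^sup>2"
      using assms(1) by simp
    then have "(cmod (\<tau> \<eta>))\<^sup>2 = 4 - M\<^sup>2"
      using \<tau>_\<delta>_bound[OF \<eta>] \<delta> by simp
    then show ?thesis
      using fourth_power_spinorI[OF \<eta> assms(3) \<delta>] \<eta> by blast
  qed
  obtain \<zeta> where "?R \<zeta>"
    using fourth_power_spinor_in_constraint_set_real[OF assms(3,4)] by blast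
  then show ?thesis
    unfolding ground_state_def is_arg_min_linorder using lower attained only by metis
qed

theorem lemma2p3:
  fixes \<beta>0 \<beta>1 \<beta>2 M :: real
  assumes "\<beta>1 < 0" and "\<beta>2 > 20 * \<beta>1" and "0 \<le> M" and "M < 2"
  shows "let m1 = sqrt (2 + M); m2 = sqrt (2 - M);
             \<xi>g = spinor (of_real (m1 ^ 4 / 16))
                         (of_real (m1 ^ 3 * m2 / 8))
                         (of_real (sqrt 6 * m1 ^ 2 * m2 ^ 2 / 16))
                         (of_real (m1 * m2 ^ 3 / 8))
                         (of_real (m2 ^ 4 / 16))
         in ground_state \<beta>0 \<beta>1 \<beta>2 M \<xi>g \<and>
            (\<forall>\<xi>. ground_state \<beta>0 \<beta>1 \<beta>2 M \<xi> \<longrightarrow> ferromagnetic \<xi> \<and> phase_equivalent \<xi>g \<xi>)"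
proof -
  define m1 where "m1 = sqrt (2 + M)"
  define m2 where "m2 = sqrt (2 - M)"
  define p s where "p = (2 + M)\<^sup>2 / 16" and "s = m2 / m1"
  define \<xi>g where "\<xi>g = spinor (of_real (m1 ^ 4 / 16))
                         (of_real (m1 ^ 3 * m2 / 8))
                         (of_real (sqrt 6 * m1 ^ 2 * m2 ^ 2 / 16))
                         (of_real (m1 * m2 ^ 3 / 8))
                         (of_real (m2 ^ 4 / 16))"
  have M: "-2 < M" "M \<le> 2" using assms by simp_all
  have "m1 > 0" using M by (simp add: m1_def)
  have p: "p = m1 ^ 4 / 16"
  proof -
    have "m1\<^sup>2 = 2 + M" using M by (simp add: m1_def)
    then show ?thesis unfolding p_def by (simp flip: power_mult \<open>m1\<^sup>2 = 2 + M\<close>)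
  qed
  have \<xi>g: "\<xi>g = fourth_power_spinor (of_real p) (of_real s)"
  proof -
    have "m1 ^ 3 * m2 / 8 = 2 * (p * s)" "sqrt 6 * m1\<^sup>2 * m2\<^sup>2 / 16 = sqrt 6 * (p * s\<^sup>2)"
      "m1 * m2 ^ 3 / 8 = 2 * (p * s ^ 3)" "m2 ^ 4 / 16 = p * s ^ 4"
      using \<open>m1 > 0\<close>
      by (simp_all add: p s_def field_simps power2_eq_square power3_eq_cube power4_eq_xxxx)
    then show ?thesis
      unfolding \<xi>g_def fourth_power_spinor_def quartic_spinor_def
      by (simp only: p of_real_mult of_real_power of_real_numeral)
  qed
  have "ground_state \<beta>0 \<beta>1 \<beta>2 M \<xi>g"
    using fourth_power_spinor_in_constraint_set_real[OF M]
    unfolding \<xi>g ground_state_iff[OF assms(1,2) M] p_def s_def m1_def m2_def by blast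
  moreover have "ferromagnetic \<xi> \<and> phase_equivalent \<xi>g \<xi>"
    if gs: "ground_state \<beta>0 \<beta>1 \<beta>2 M \<xi>" for \<xi>
  proof
    obtain q t where q: "\<xi> = fourth_power_spinor q t"
      and \<xi>: "fourth_power_spinor q t \<in> constraint_set M"
      using gs unfolding ground_state_iff[OF assms(1,2) M] by blast
    have "M\<^sup>2 < 2\<^sup>2"
      using assms(3,4) by (intro power_strict_mono) simp_all
    then have "(cmod (\<tau> \<xi>))\<^sup>2 > 0"
      using \<tau>_fourth_power_spinor[OF \<xi>] by (simp add: q)
    then show "ferromagnetic \<xi>"
      by (simp add: ferromagnetic_def q \<delta>_fourth_power_spinor)
    have "0 \<le> s" "0 \<le> p" using M by (simp_all add: s_def p_def m1_def m2_def)
    moreover have "cmod q = p" "cmod t = s"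
      using fourth_power_spinor_moduli[OF \<xi> M] by (simp_all add: p_def s_def m1_def m2_def)
    ultimately show "phase_equivalent \<xi>g \<xi>"
      unfolding \<xi>g q by (intro phase_equivalent_fourth_power_spinor) simp_all
  qed
  ultimately show ?thesis
    unfolding \<xi>g_def m1_def m2_def Let_def by blast
qed

end
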